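(* Let $n\ge1$ and let $a_{ij}$ ($i=0,\dots,n$, $j=1,\dots,n$) be positive integers with $a_{0j}\le\dots\le a_{n-1,j}$ for every $j$; let $\mathcal{A}_i=\{b\in\mathbb{Z}^n:0\le b_j\le a_{ij}\}$ with $S(\rho)$, $\mathcal{B}$, $t_b$, $i(b)$, $a(b)$, $\varphi_b$, $\mathcal{G}$, $I_b$, $g_b$ as in the context. Let $b\in\mathcal{G}$ with $g_b=K>0$. Then there is $b'\in\mathcal{G}$ with $g_{b'}=K-1$ such that for some $\overline{b}\in b'-a(b')+\mathcal{A}_{i(b')}$ one has $\varphi_{\overline{b}}=\varphi_b$; moreover $b$ is reached from $b'$, i.e. there exist $c_0=b',c_1,\dots,c_m=b$ in $\mathcal{B}$ with $c_{k+1}\in c_k-a(c_k)+\mathcal{A}_{i(c_k)}$ for all $k$.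
   Context: $\Delta_i=\mathrm{conv}(\mathcal{A}_i)$, $\Delta=\sum_i\Delta_i$. Fix $v\in\mathbb{R}^n$ with all $v_j<0$ and sufficiently small reals $\lambda_0>\dots>\lambda_n\ge0$; the lifting $\omega_i(x)=\lambda_i\langle v,x\rangle$ on $\mathcal{A}_i$ induces a coherent mixed subdivision $S(\rho)$ of $\Delta$ whose cells have components $D=D_0+\dots+D_n$. Fix $\delta\in\mathbb{R}^n$ with all coordinates negative and sufficiently small (generic), $\mathcal{B}=(\Delta+\delta)\cap\mathbb{Z}^n$. For $b\in\mathcal{B}$ in a translated $n$-cell $D+\delta$: $t_{b,i}=\dim D_i$, $i(b)=\max\{i:t_{b,i}=0\}$, $a(b)$ the point $D_{i(b)}$. $b$ lies in a mixed cell if exactly one $t_{b,i}$ is $0$, otherwise in a non-mixed cell. The type function $\varphi_b:\{1,\dots,n\}\to\{0,\dots,n\}$ is given by $\sum_{k=0}^{\varphi_b(j)-1}a_{kj}\le b_j<\sum_{k=0}^{\varphi_b(j)}a_{kj}$. $\mathcal{G}=\{b\in\mathcal{B}:\sum_{i=0}^It_{b,i}\le I+1\ \forall I<n\}$. $I_b=\max\{i:t_{b,i}\ge2\}$ if $b$ lies in a non-mixed cell and $I_b=0$ if $b$ lies in a mixed cell; $g_b=|\{i<I_b: t_{b,i}=0\}|$. *)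

theory Defs
  imports "HOL-Analysis.Analysis"
begin

definition lifted :: "'a::euclidean_space set \<Rightarrow> ('a \<Rightarrow> real) \<Rightarrow> ('a \<times> real) set" where
  "lifted A \<omega> = convex hull ((\<lambda>x. (x, \<omega> x)) ` A)"

text \<open>The face of \<open>P\<close> with inner normal \<open>(u, 1)\<close>; the faces of this form make up the lower
  envelope of \<open>P\<close>.\<close>

definition lower_face :: "'a::euclidean_space \<Rightarrow> ('a \<times> real) set \<Rightarrow> ('a \<times> real) set" where
  "lower_face u P = {p \<in> P. \<forall>q \<in> P. inner (u, 1) p \<le> inner (u, 1) q}"

text \<open>The sum over \<open>i\<close> is a Minkowski sum. Cells of all dimensions are included.\<close>

definition mixed_subdivision ::
    "nat \<Rightarrow> (nat \<Rightarrow> 'a::euclidean_space set) \<Rightarrow> (nat \<Rightarrow> 'a \<Rightarrow> real) \<Rightarrow> 'a set set" where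
  "mixed_subdivision N A \<omega> =
     {fst ` lower_face u (\<Sum>i\<le>N. lifted (A i) (\<omega> i)) | u. True}"

text \<open>The summand \<open>D\<^sub>i\<close> in \<open>D = D\<^sub>0 + \<dots> + D\<^sub>N\<close>: the face of the Minkowski sum in a direction is the
  sum of the faces of the summands in the same direction, and \<open>D\<^sub>i\<close> depends only on \<open>D\<close>, not
  on the direction that cuts it out.\<close>

definition cell_component ::
    "nat \<Rightarrow> (nat \<Rightarrow> 'a::euclidean_space set) \<Rightarrow> (nat \<Rightarrow> 'a \<Rightarrow> real) \<Rightarrow> 'a set \<Rightarrow> nat \<Rightarrow> 'a set" where
  "cell_component N A \<omega> D i =
     (THE F. \<exists>u. D = fst ` lower_face u (\<Sum>k\<le>N. lifted (A k) (\<omega> k)) \<and>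
                 F = fst ` lower_face u (lifted (A i) (\<omega> i)))"

definition full_cells ::
    "nat \<Rightarrow> (nat \<Rightarrow> 'a::euclidean_space set) \<Rightarrow> (nat \<Rightarrow> 'a \<Rightarrow> real) \<Rightarrow> 'a set set" where
  "full_cells N A \<omega> = {D \<in> mixed_subdivision N A \<omega>. aff_dim D = int DIM('a)}"


text \<open>The dimension \<open>n\<close> is \<open>CARD('n)\<close> throughout, and the supports are indexed by \<open>i \<le> CARD('n)\<close>;
  \<open>a i j\<close> is \<open>a\<^sub>i\<^sub>j\<close>. Lattice points are the vectors with all coordinates in \<open>\<int>\<close>.\<close>

locale box_system =
  fixes a :: "nat \<Rightarrow> 'n::finite \<Rightarrow> nat"
    and v :: "real ^ 'n"
    and lam :: "nat \<Rightarrow> real"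
    and \<delta> :: "real ^ 'n"
begin

definition supp :: "nat \<Rightarrow> (real ^ 'n) set" where
  "supp i = {x. \<forall>j. x $ j \<in> \<int> \<and> 0 \<le> x $ j \<and> x $ j \<le> real (a i j)}"

definition lifting :: "nat \<Rightarrow> real ^ 'n \<Rightarrow> real" where
  "lifting i x = lam i * inner v x"

definition Delta :: "(real ^ 'n) set" where
  "Delta = (\<Sum>i\<le>CARD('n). convex hull (supp i))"

definition B :: "(real ^ 'n) set" where
  "B = {b \<in> (\<lambda>x. x + \<delta>) ` Delta. \<forall>j. b $ j \<in> \<int>}"

definition generic_shift :: bool where
  "generic_shift \<longleftrightarrow>
     (\<forall>b\<in>B. \<exists>D \<in> full_cells CARD('n) supp lifting. b \<in> interior ((\<lambda>x. x + \<delta>) ` D))"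

text \<open>Under \<open>generic_shift\<close> the cell below exists and is unique for every \<open>b \<in> B\<close>.\<close>

definition cell_of :: "real ^ 'n \<Rightarrow> (real ^ 'n) set" where
  "cell_of b = (THE D. D \<in> full_cells CARD('n) supp lifting \<and> b \<in> (\<lambda>x. x + \<delta>) ` D)"

definition component :: "real ^ 'n \<Rightarrow> nat \<Rightarrow> (real ^ 'n) set" where
  "component b i = cell_component CARD('n) supp lifting (cell_of b) i"

definition t :: "real ^ 'n \<Rightarrow> nat \<Rightarrow> int" where
  "t b i = aff_dim (component b i)"

definition row_index :: "real ^ 'n \<Rightarrow> nat" where
  "row_index b = Max {i. i \<le> CARD('n) \<and> t b i = 0}"

definition row_point :: "real ^ 'n \<Rightarrow> real ^ 'n" where
  "row_point b = (THE x. component b (row_index b) = {x})"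

definition row_content :: "real ^ 'n \<Rightarrow> (real ^ 'n) set" where
  "row_content b = (\<lambda>x. b - row_point b + x) ` supp (row_index b)"

definition in_mixed_cell :: "real ^ 'n \<Rightarrow> bool" where
  "in_mixed_cell b \<longleftrightarrow> (\<exists>!i. i \<le> CARD('n) \<and> t b i = 0)"

text \<open>Meaningful only for \<open>b \<in> B\<close>, where each \<open>b $ j\<close> lies in exactly one of the intervals.\<close>

definition type_fun :: "real ^ 'n \<Rightarrow> 'n \<Rightarrow> nat" where
  "type_fun b j = (THE i. i \<le> CARD('n) \<and>
     real (\<Sum>k<i. a k j) \<le> b $ j \<and> b $ j < real (\<Sum>k\<le>i. a k j))"

definition G :: "(real ^ 'n) set" where
  "G = {b \<in> B. \<forall>I < CARD('n). (\<Sum>i\<le>I. t b i) \<le> int I + 1}"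

definition I_max :: "real ^ 'n \<Rightarrow> nat" where
  "I_max b = (if in_mixed_cell b then 0 else Max {i. i \<le> CARD('n) \<and> t b i \<ge> 2})"

definition g :: "real ^ 'n \<Rightarrow> nat" where
  "g b = card {i. i < I_max b \<and> t b i = 0}"

definition reached_from :: "real ^ 'n \<Rightarrow> real ^ 'n \<Rightarrow> bool" where
  "reached_from b b' \<longleftrightarrow>
     (\<exists>m. \<exists>c :: nat \<Rightarrow> real ^ 'n. c 0 = b' \<and> c m = b \<and> (\<forall>k\<le>m. c k \<in> B) \<and>
        (\<forall>k<m. c (Suc k) \<in> row_content (c k)))"

end

end

theory Submission
  imports Defs
begin

text \<open>Because \<open>v\<close> is negative and \<open>\<lambda>\<close> is decreasing, the coefficient \<open>u\<^sub>j + \<lambda>\<^sub>i v\<^sub>j\<close> is strictly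
  increasing in \<open>i\<close>. Hence the full-dimensional cells are the boxes
  \<open>\<Prod>\<^sub>j [\<Sum>\<^bsub>k < \<phi> j\<^esub> a\<^sub>k\<^sub>j, \<Sum>\<^bsub>k \<le> \<phi> j\<^esub> a\<^sub>k\<^sub>j]\<close>, one for each type \<open>\<phi>\<close>, and \<open>t\<^sub>b\<^sub>,\<^sub>i\<close> is the number of
  coordinates \<open>j\<close> with \<open>\<phi>\<^sub>b j = i\<close>. Membership in \<open>G\<close> and the value \<open>g\<close> depend only on these
  numbers.

  To decrease \<open>g\<close>, lower the type of some coordinates by one, moving each of them to the last
  lattice point below its interval. This is arranged so that the row index \<open>q\<close> of the new point
  \<open>b'\<close> is at least the old type of every moved coordinate, and so that every coordinate of type \<open>q\<close>
  is moved. On the way back the coordinates whose type in \<open>b\<close> is not \<open>q\<close> are raised first, by unit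
  steps; meanwhile no coordinate has type \<open>q\<close>, so the row index stays \<open>q\<close>. A single final step
  raises the coordinates of type \<open>q\<close>.\<close>

section \<open>Zeros of level counts\<close>

definition zeros :: "nat \<Rightarrow> (nat \<Rightarrow> nat) \<Rightarrow> nat set" where
  "zeros n t = {i. i \<le> n \<and> t i = 0}"

text \<open>Counterparts of \<open>I_max\<close>, \<open>g\<close> and \<open>G\<close> for an
  arbitrary sequence of naturals, so that the counting arguments need no geometry.\<close>

definition last_big :: "nat \<Rightarrow> (nat \<Rightarrow> nat) \<Rightarrow> nat" where
  "last_big n t = (if \<exists>!i. i \<le> n \<and> t i = 0 then 0 else Max {i. i \<le> n \<and> t i \<ge> 2})"

definition zeros_below :: "nat \<Rightarrow> (nat \<Rightarrow> nat) \<Rightarrow> nat" where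
  "zeros_below n t = card {i. i < last_big n t \<and> t i = 0}"

definition admissible :: "nat \<Rightarrow> (nat \<Rightarrow> nat) \<Rightarrow> bool" where
  "admissible n t \<longleftrightarrow> (\<forall>I<n. (\<Sum>i\<le>I. t i) \<le> I + 1)"

lemma finite_zeros [simp]: "finite (zeros n t)"
  by (simp add: zeros_def)

lemma sum_split_nat:
  fixes t :: "nat \<Rightarrow> nat"
  assumes "I \<le> n" shows "(\<Sum>i\<le>n. t i) = (\<Sum>i\<le>I. t i) + (\<Sum>i\<in>{I<..n}. t i)"
proof -
  have "{..n} = {..I} \<union> {I<..n}" using assms by auto
  then show ?thesis by (simp add: sum.union_disjoint disjoint_iff)
qed

lemma zeros_nonempty:
  assumes "(\<Sum>i\<le>n. t i) = n"
  shows "zeros n t \<noteq> {}"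
proof
  assume "zeros n t = {}"
  then have "\<And>i. i \<le> n \<Longrightarrow> 1 \<le> t i" by (auto simp: zeros_def Suc_le_eq)
  then have "(\<Sum>i\<le>n. 1) \<le> (\<Sum>i\<le>n. t i)" by (intro sum_mono) auto
  then show False using assms by simp
qed

text \<open>With a single zero, the n - 1 entries other than it and \<open>t i\<close> are positive,
  so the total is at least n + 1.\<close>

lemma zeros_card_ge_2:
  fixes t :: "nat \<Rightarrow> nat"
  assumes sum: "(\<Sum>i\<le>n. t i) = n" and ex: "i \<le> n" "2 \<le> t i"
  shows "2 \<le> card (zeros n t)"
proof (rule ccontr)
  assume "\<not> 2 \<le> card (zeros n t)"
  then obtain p where p: "zeros n t = {p}"
  proof -
    have "card (zeros n t) \<noteq> 0" using zeros_nonempty[OF sum] by simp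
    then have "card (zeros n t) = 1" using \<open>\<not> 2 \<le> card (zeros n t)\<close> by linarith
    then show thesis using that card_1_singletonE by blast
  qed
  have "1 \<le> t k" if "k \<in> {..n}-{p}-{i}" for k
  proof -
    have "k \<notin> zeros n t" using p that by simp
    then show ?thesis using that by (simp add: zeros_def)
  qed
  then have "(\<Sum>k\<in>{..n}-{p}-{i}. 1) \<le> (\<Sum>k\<in>{..n}-{p}-{i}. t k)" by (rule sum_mono)
  moreover have "p \<in> zeros n t" using p by simp
  then have "p \<le> n" "t p = 0" by (auto simp: zeros_def)
  moreover from this have "(\<Sum>k\<le>n. t k) = t p + (t i + (\<Sum>k\<in>{..n}-{p}-{i}. t k))"
    using ex by (subst sum.remove[of _ p]; simp) (subst sum.remove[of _ i]; auto)
  moreover have "card ({..n} - {p} - {i}) = n - 1"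
    using \<open>p \<le> n\<close> \<open>t p = 0\<close> ex by (subst card_Diff_singleton) auto
  ultimately show False using ex sum by simp
qed

lemma all_le_one_of_unique_zero:
  fixes t :: "nat \<Rightarrow> nat"
  assumes sum: "(\<Sum>i\<le>n. t i) = n" and "\<exists>!i. i \<le> n \<and> t i = 0" "i \<le> n"
  shows "t i \<le> 1"
proof (rule ccontr)
  assume "\<not> t i \<le> 1"
  then have "2 \<le> card (zeros n t)" using zeros_card_ge_2[OF sum \<open>i \<le> n\<close>] by simp
  moreover obtain p where "zeros n t = {p}" using assms(2) by (auto simp: zeros_def)
  ultimately show False by simp
qed

text \<open>Two zeros and n - 1 further entries that are at most 1 sum to less than n. Hence the
  \<open>Max\<close> in \<open>last_big\<close> is taken over a nonempty set.\<close>

lemma big_of_not_unique_zero: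
  fixes t :: "nat \<Rightarrow> nat"
  assumes sum: "(\<Sum>i\<le>n. t i) = n" and nu: "\<not> (\<exists>!i. i \<le> n \<and> t i = 0)"
  shows "{i. i \<le> n \<and> t i \<ge> 2} \<noteq> {}"
proof
  assume "{i. i \<le> n \<and> t i \<ge> 2} = {}"
  then have le: "t i \<le> 1" if "i \<le> n" for i
    using that by (metis (mono_tags, lifting) One_nat_def Suc_1 empty_iff mem_Collect_eq not_less_eq_eq)
  obtain p where "p \<in> zeros n t" using zeros_nonempty[OF sum] by blast
  then obtain q where p: "p \<le> n" "t p = 0" and q: "q \<le> n" "t q = 0" "q \<noteq> p"
    using nu by (auto simp: zeros_def)
  have "(\<Sum>k\<le>n. t k) = t p + (t q + (\<Sum>k\<in>{..n}-{p}-{q}. t k))"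
    using p q by (subst sum.remove[of _ p]; simp) (subst sum.remove[of _ q]; auto)
  also have "\<dots> \<le> (\<Sum>k\<in>{..n}-{p}-{q}. 1)"
    using p q le by (simp only: add_0) (rule sum_mono, auto)
  also have "\<dots> = n - 1" using p q by simp
  finally show False using sum p q by simp
qed

lemma last_big:
  fixes t :: "nat \<Rightarrow> nat"
  assumes sum: "(\<Sum>i\<le>n. t i) = n" and nu: "\<not> (\<exists>!i. i \<le> n \<and> t i = 0)"
  shows "last_big n t \<le> n" "2 \<le> t (last_big n t)"
    "\<And>i. last_big n t < i \<Longrightarrow> i \<le> n \<Longrightarrow> t i \<le> 1"
proof -
  let ?S = "{i. i \<le> n \<and> t i \<ge> 2}"
  have I: "last_big n t = Max ?S" using nu by (simp add: last_big_def)
  have "Max ?S \<in> ?S" using big_of_not_unique_zero[OF assms] by (intro Max_in) auto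
  then show "last_big n t \<le> n" "2 \<le> t (last_big n t)" using I by auto
  fix i assume "last_big n t < i" "i \<le> n"
  then show "t i \<le> 1" using I
  proof -
    have "i \<notin> ?S"
    proof
      assume "i \<in> ?S"
      then have "i \<le> Max ?S" by (intro Max_ge) auto
      then show False using \<open>last_big n t < i\<close> I by simp
    qed
    then show ?thesis using \<open>i \<le> n\<close> by simp
  qed
qed

text \<open>With \<open>I = last_big n t\<close>, the \<open>n - I\<close> entries above \<open>I\<close> sum to at least \<open>n - I - 1\<close> by
  admissibility, and each is at most \<open>1\<close>.\<close>

lemma zero_above_last_big_unique:
  fixes t :: "nat \<Rightarrow> nat"
  assumes sum: "(\<Sum>i\<le>n. t i) = n" and nu: "\<not> (\<exists>!i. i \<le> n \<and> t i = 0)"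
    and adm: "admissible n t"
    and pq: "p \<in> zeros n t" "q \<in> zeros n t" "last_big n t < p" "last_big n t < q"
  shows "p = q"
proof (rule ccontr)
  assume ne: "p \<noteq> q"
  let ?I = "last_big n t"
  let ?A = "{?I<..n} - {p} - {q}"
  have p: "p \<le> n" "t p = 0" and q: "q \<le> n" "t q = 0" using pq by (auto simp: zeros_def)
  have "(\<Sum>k\<in>{?I<..n}. t k) = t p + (t q + (\<Sum>k\<in>?A. t k))"
    using p q pq ne by (subst sum.remove[of _ p]; simp) (subst sum.remove[of _ q]; auto)
  also have "\<dots> \<le> (\<Sum>k\<in>?A. 1)"
    using p q last_big(3)[OF sum nu] by (simp only: add_0) (rule sum_mono, auto)
  also have "\<dots> = n - ?I - 2" using p q pq ne by simp
  finally have "(\<Sum>k\<in>{?I<..n}. t k) \<le> n - ?I - 2" .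
  moreover have "(\<Sum>i\<le>?I. t i) \<le> ?I + 1"
    using adm p pq unfolding admissible_def by simp
  moreover have "?I + 2 \<le> n" using p q pq ne by linarith
  ultimately show False
    using sum sum_split_nat[of ?I n t] by linarith
qed

text \<open>At most one zero lies above the last big entry, and it can only be the largest zero p.
  So every zero is counted, except p when no big entry follows it. This evaluates
  \<open>zeros_below\<close> without mentioning \<open>last_big\<close>.\<close>

lemma zeros_below_eq:
  assumes sum: "(\<Sum>i\<le>n. t i) = n" and adm: "admissible n t"
    and p: "p \<in> zeros n t" "\<And>i. p < i \<Longrightarrow> i \<le> n \<Longrightarrow> 0 < t i"
  shows "zeros_below n t =
    card (zeros n t) - (if \<forall>i. p < i \<longrightarrow> i \<le> n \<longrightarrow> t i \<le> 1 then 1 else 0)"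
proof (cases "\<exists>!i. i \<le> n \<and> t i = 0")
  case True
  then obtain q where "zeros n t = {q}" by (auto simp: zeros_def)
  then show ?thesis
    using True all_le_one_of_unique_zero[OF sum True]
    by (auto simp: zeros_below_def last_big_def)
next
  case False
  let ?I = "last_big n t"
  note I = last_big[OF sum False]
  have pz: "p \<le> n" "t p = 0" using p by (auto simp: zeros_def)
  then have "?I \<noteq> p" using I by auto
  then consider "?I < p" | "p < ?I" by linarith
  then show ?thesis
  proof cases
    case 1
    then have small: "\<forall>i. p < i \<longrightarrow> i \<le> n \<longrightarrow> t i \<le> 1" using I(3) by force
    have "{i. i < ?I \<and> t i = 0} = zeros n t - {p}"
    proof (intro equalityI subsetI)
      fix i assume i: "i \<in> zeros n t - {p}"
      then have "\<not> ?I < i"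
        using zero_above_last_big_unique[OF sum False adm _ p(1) _ 1] by blast
      moreover have "i \<noteq> ?I" using i I by (auto simp: zeros_def)
      ultimately show "i \<in> {i. i < ?I \<and> t i = 0}" using i by (auto simp: zeros_def)
    qed (use 1 pz in \<open>auto simp: zeros_def\<close>)
    then show ?thesis using small p by (simp add: zeros_below_def)
  next
    case 2
    then have big: "\<not> (\<forall>i. p < i \<longrightarrow> i \<le> n \<longrightarrow> t i \<le> 1)" using I by force
    have "{i. i < ?I \<and> t i = 0} = zeros n t"
      using p(2) 2 I by (auto simp: zeros_def) (metis less_numeral_extra(3) linorder_neqE_nat less_trans)
    then show ?thesis unfolding if_not_P[OF big] by (simp add: zeros_below_def)
  qed
qed

text \<open>A unit that moves down within the levels 0 to I leaves the sum unchanged, and only the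
  units from level I + 1 enter.\<close>

lemma sum_atMost_shift:
  fixes t m :: "nat \<Rightarrow> nat"
  assumes "m 0 = 0" "\<And>i. m i \<le> t i"
  shows "(\<Sum>i\<le>I. t i - m i + m (Suc i)) = (\<Sum>i\<le>I. t i) + m (Suc I)"
proof (induction I)
  case (Suc I)
  then show ?case using assms(2)[of "Suc I"] by simp
qed (use assms in simp)

text \<open>Here \<open>m i\<close> is the number of coordinates to be moved from level \<open>i\<close> to level \<open>i - 1\<close>, and \<open>q\<close>
  is the largest zero afterwards. Two cases: if all entries above the largest zero are \<open>1\<close>, fill the
  previous zero by a chain that ends at the last big entry; otherwise fill the largest zero by a
  chain that ends at \<open>n\<close> and empties level \<open>n\<close>.\<close>

lemma exists_shift:
  assumes sum: "(\<Sum>i\<le>n. t i) = n" and adm: "admissible n t" and out: "\<And>i. n < i \<Longrightarrow> t i = 0"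
    and K: "zeros_below n t = K" "0 < K"
  obtains m q where "q \<le> n" "m 0 = 0" "\<And>i. m i \<le> t i" "m q = t q"
    "\<And>i. q < i \<Longrightarrow> m i = 0" "\<And>i. q < i \<Longrightarrow> i \<le> n \<Longrightarrow> 0 < t i"
    "admissible n (\<lambda>i. t i - m i + m (Suc i))"
    "zeros_below n (\<lambda>i. t i - m i + m (Suc i)) = K - 1"
proof -
  have nu: "\<not> (\<exists>!i. i \<le> n \<and> t i = 0)"
    using K by (auto simp: zeros_below_def last_big_def split: if_splits)
  define p where "p = Max (zeros n t)"
  have pZ: "p \<in> zeros n t" unfolding p_def by (rule Max_in) (simp_all add: zeros_nonempty[OF sum])
  have above_p: "0 < t i" if "p < i" "i \<le> n" for i
  proof (rule ccontr)
    assume "\<not> 0 < t i"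
    then have "i \<le> p" unfolding p_def using that by (intro Max_ge) (auto simp: zeros_def)
    then show False using that by simp
  qed
  have p: "p \<le> n" "t p = 0" using pZ by (auto simp: zeros_def)
  note K_eq = zeros_below_eq[OF sum adm pZ above_p]
  note finish = that
  \<comment> \<open>After the shift q is a zero and all later entries are 1, so
    \<open>zeros_below_eq\<close> subtracts one from the number K of zeros. Both cases below only
    supply m and q.\<close>
  have shifted: thesis
    if m: "q \<le> n" "m 0 = 0" "\<And>i. m i \<le> t i" "m q = t q"
      "\<And>i. q < i \<Longrightarrow> m i = 0" "\<And>i. q < i \<Longrightarrow> i \<le> n \<Longrightarrow> 0 < t i \<and> t i \<le> 1"
      and adm': "\<And>I. I < n \<Longrightarrow> 0 < m (Suc I) \<Longrightarrow> (\<Sum>i\<le>I. t i) + m (Suc I) \<le> I + 1"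
      and card: "card (zeros n (\<lambda>i. t i - m i + m (Suc i))) = K" for m q
  proof -
    define t' where "t' = (\<lambda>i. t i - m i + m (Suc i))"
    \<comment> \<open>Nothing enters from above level n, so the total stays n.\<close>
    have "m (Suc n) = 0" using m(3)[of "Suc n"] out by simp
    then have sum': "(\<Sum>i\<le>n. t' i) = n"
      using sum_atMost_shift[of m t n] m(2,3) sum by (simp add: t'_def)
    have "admissible n t'"
      unfolding admissible_def t'_def sum_atMost_shift[of m t, OF m(2,3)]
    proof (intro allI impI)
      fix I assume "I < n"
      then show "(\<Sum>i\<le>I. t i) + m (Suc I) \<le> I + 1"
        using adm' adm by (cases "m (Suc I) = 0") (auto simp: admissible_def)
    qed
    moreover have "q \<in> zeros n t'" using m(1,4) m(5)[of "Suc q"] by (simp add: zeros_def t'_def)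
    moreover have "t' i = t i" if "q < i" for i using m(5) that by (simp add: t'_def)
    ultimately have "zeros_below n t' = K - 1"
      using zeros_below_eq[OF sum' _ \<open>q \<in> zeros n t'\<close>] m(6) card by (simp add: t'_def)
    then show thesis
      using finish[OF m(1-5)] m(6) \<open>admissible n t'\<close> unfolding t'_def by blast
  qed
  show thesis
  proof (cases "\<forall>i. p < i \<longrightarrow> i \<le> n \<longrightarrow> t i \<le> 1")
    case True
    let ?I = "last_big n t"
    note I = last_big[OF sum nu]
    have "?I < p"
      proof (rule ccontr)
      assume "\<not> ?I < p"
      moreover have "?I \<noteq> p" using I p by auto
      ultimately have "t ?I \<le> 1" using True I by auto
      then show False using I(2) by simp
    qed
    \<comment> \<open>The zero p is not counted by \<open>zeros_below\<close>, so there are K + 1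
      zeros and the shift has to remove one.\<close>
    have cardZ: "card (zeros n t) = Suc K" using K_eq True K pZ by (auto simp: card_gt_0_iff)
    then have "zeros n t - {p} \<noteq> {}" using K pZ by (metis card_Diff_singleton card.empty diff_Suc_1 less_numeral_extra(3))
    define s where "s = Max (zeros n t - {p})"
    have sZ: "s \<in> zeros n t - {p}" unfolding s_def using \<open>zeros n t - {p} \<noteq> {}\<close> by (intro Max_in) auto
    have s: "s \<le> n" "t s = 0" using sZ by (auto simp: zeros_def)
    have "\<not> ?I < s"
      using zero_above_last_big_unique[OF sum nu adm _ pZ _ \<open>?I < p\<close>] sZ by blast
    moreover have "s \<noteq> ?I" using s I by auto
    ultimately have "s < ?I" by simp
    have pos: "0 < t i" if "s < i" "i \<le> ?I" for i
    proof (rule ccontr)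
      assume "\<not> 0 < t i"
      then have "i \<le> s" unfolding s_def using that \<open>?I < p\<close> p
        by (intro Max_ge) (auto simp: zeros_def)
      then show False using that by simp
    qed
    \<comment> \<open>One unit leaves each of the levels s + 1 to \<open>?I\<close> for the level
      below. This fills s, costs \<open>?I\<close> one of its at least two units, and leaves the
      counts in between unchanged.\<close>
    define m where "m i = (if s < i \<and> i \<le> ?I then 1 else 0 :: nat)" for i
    show thesis
    proof (rule shifted[of p m])
      show "m i \<le> t i" for i using pos by (auto simp: m_def Suc_le_eq)
      show "(\<Sum>i\<le>I. t i) + m (Suc I) \<le> I + 1" if "I < n" "0 < m (Suc I)" for I
      proof -
        have I': "s \<le> I" "I < ?I" using that by (auto simp: m_def split: if_splits)
        \<comment> \<open>The levels I + 1 to \<open>?I\<close> are positive and the last of them is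
          at least 2, so they hold at least \<open>?I\<close> - I + 1 units. At most
          \<open>?I\<close> + 1 units lie up to \<open>?I\<close>, which leaves at most I up to
          level I and room for one more.\<close>
        have "(\<Sum>i\<in>{I<..<?I}. 1) \<le> (\<Sum>i\<in>{I<..<?I}. t i)"
          using pos I' by (intro sum_mono) (auto simp: Suc_le_eq)
        moreover have "{I<..?I} = insert ?I {I<..<?I}" using I' by auto
        ultimately have "?I - I + 1 \<le> (\<Sum>i\<in>{I<..?I}. t i)" using I(2) I' by simp
        moreover have "(\<Sum>i\<le>?I. t i) \<le> ?I + 1"
          using adm \<open>?I < p\<close> p unfolding admissible_def by simp
        ultimately show ?thesis
          using sum_split_nat[of I ?I t] I' by (simp add: m_def)
      qed
      have "zeros n (\<lambda>i. t i - m i + m (Suc i)) = zeros n t - {s}"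
      proof -
        have "t i - m i + m (Suc i) = 0 \<longleftrightarrow> t i = 0 \<and> i \<noteq> s" for i
        proof -
          consider "i = s" | "i < s \<or> ?I < i" | "s < i" "i < ?I" | "i = ?I" "s < i"
            using \<open>s < ?I\<close> by linarith
          then show ?thesis
          proof cases
            case 3
            then show ?thesis using pos[of i] by (simp add: m_def)
          qed (use \<open>s < ?I\<close> I(2) in \<open>auto simp: m_def\<close>)
        qed
        then show ?thesis by (auto simp: zeros_def)
      qed
      then show "card (zeros n (\<lambda>i. t i - m i + m (Suc i))) = K"
        using cardZ sZ by simp
    qed (use p \<open>?I < p\<close> above_p True in \<open>auto simp: m_def\<close>)
  next
    case False
    then have "p < n" by auto
    have cardZ: "card (zeros n t) = K" using K_eq K unfolding if_not_P[OF False] by simp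
    \<comment> \<open>All K zeros are counted here, so their number has to stay while the largest
      one moves to n. Level n is emptied and one unit leaves every level strictly between p and n;
      this fills p.\<close>
    define m where "m i = (if i = n then t n else if p < i \<and> i < n then 1 else 0)" for i
    have le: "(\<Sum>i\<le>I. t i) \<le> I" if "p \<le> I" "I < n" for I
    proof -
      have "(\<Sum>i\<in>{I<..n}. 1) \<le> (\<Sum>i\<in>{I<..n}. t i)"
        using above_p that by (intro sum_mono) (auto simp: Suc_le_eq)
      then show ?thesis using sum_split_nat[of I n t] that sum by simp
    qed
    show thesis
    proof (rule shifted[of n m])
      show "m i \<le> t i" for i using above_p by (auto simp: m_def Suc_le_eq)
      show "(\<Sum>i\<le>I. t i) + m (Suc I) \<le> I + 1" if "I < n" "0 < m (Suc I)" for I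
      proof (cases "Suc I = n")
        case True
        then show ?thesis using sum by (auto simp: m_def)
      next
        case False
        then show ?thesis using le[of I] that by (auto simp: m_def split: if_splits)
      qed
      have "zeros n (\<lambda>i. t i - m i + m (Suc i)) = insert n (zeros n t - {p})"
      proof -
        have "t i - m i + m (Suc i) = 0 \<longleftrightarrow> i = n \<or> t i = 0 \<and> i \<noteq> p" if "i \<le> n" for i
        proof -
          consider "i = n" | "i < p" | "p \<le> i" "i < n" using \<open>i \<le> n\<close> by linarith
          then show ?thesis
          proof cases
            case 3
            \<comment> \<open>If level i + 1 is n, it delivers \<open>t n\<close> units, which is
              positive because n > p.\<close>
            then have "0 < m (Suc i)" using above_p[of n] by (auto simp: m_def)
            moreover have "0 < t i \<or> i = p" using 3 above_p[of i] by fastforce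
            ultimately show ?thesis using 3 by auto
          qed (use \<open>p < n\<close> out in \<open>auto simp: m_def\<close>)
        qed
        then show ?thesis using \<open>p < n\<close> by (auto simp: zeros_def)
      qed
      moreover have "n \<notin> zeros n t" using above_p[OF \<open>p < n\<close>] by (simp add: zeros_def)
      ultimately show "card (zeros n (\<lambda>i. t i - m i + m (Suc i))) = K"
        using cardZ pZ K by simp
    qed (use \<open>p < n\<close> out in \<open>auto simp: m_def\<close>)
  qed
qed

section \<open>Lower faces of lifted boxes\<close>

text \<open>A linear functional is minimal at a sum of points exactly when it is minimal at each
  summand, since one summand can be exchanged at a time.\<close>

lemma lower_face_sum:
  assumes "finite I"
  shows "lower_face u (\<Sum>i\<in>I. P i) = (\<Sum>i\<in>I. lower_face u (P i))"
proof (intro equalityI subsetI)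
  fix p assume p: "p \<in> lower_face u (\<Sum>i\<in>I. P i)"
  then have "p \<in> (\<Sum>i\<in>I. P i)" by (simp add: lower_face_def)
  then obtain s where s: "\<And>i. i \<in> I \<Longrightarrow> s i \<in> P i" and ps: "p = sum s I"
    unfolding set_sum_alt[OF assms] by blast
  have "s i \<in> lower_face u (P i)" if i: "i \<in> I" for i
  proof -
    have "inner (u, 1) (s i) \<le> inner (u, 1) q" if q: "q \<in> P i" for q
    proof -
      let ?s = "s(i := q)"
      have "sum ?s I \<in> (\<Sum>i\<in>I. P i)"
        unfolding set_sum_alt[OF assms] using s q by auto
      then have "inner (u, 1) (sum s I) \<le> inner (u, 1) (sum ?s I)"
        using p ps by (auto simp: lower_face_def)
      moreover have "sum ?s I = q + sum s (I - {i})" "sum s I = s i + sum s (I - {i})"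
        using sum.remove[OF assms i, of ?s] sum.remove[OF assms i, of s] by auto
      ultimately show ?thesis by (simp only: inner_add_right)
    qed
    then show ?thesis using s[OF i] by (auto simp: lower_face_def)
  qed
  then show "p \<in> (\<Sum>i\<in>I. lower_face u (P i))"
    unfolding set_sum_alt[OF assms] using ps by blast
next
  fix p assume "p \<in> (\<Sum>i\<in>I. lower_face u (P i))"
  then obtain s where s: "\<And>i. i \<in> I \<Longrightarrow> s i \<in> lower_face u (P i)" and ps: "p = sum s I"
    by (auto simp: set_sum_alt[OF assms])
  have "inner (u, 1) p \<le> inner (u, 1) q" if q: "q \<in> (\<Sum>i\<in>I. P i)" for q
  proof -
    obtain r where r: "\<And>i. i \<in> I \<Longrightarrow> r i \<in> P i" and qr: "q = sum r I"
      using q unfolding set_sum_alt[OF assms] by blast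
    show ?thesis unfolding ps qr inner_sum_right
      using s r by (intro sum_mono) (auto simp: lower_face_def)
  qed
  moreover have "p \<in> (\<Sum>i\<in>I. P i)"
    unfolding set_sum_alt[OF assms] ps using s by (auto simp: lower_face_def)
  ultimately show "p \<in> lower_face u (\<Sum>i\<in>I. P i)" by (auto simp: lower_face_def)
qed

lemma fst_image_sum:
  assumes "finite I"
  shows "fst ` (\<Sum>i\<in>I. P i) = (\<Sum>i\<in>I. fst ` P i)"
proof (intro equalityI subsetI)
  fix x assume "x \<in> fst ` (\<Sum>i\<in>I. P i)"
  then obtain s where "\<And>i. i \<in> I \<Longrightarrow> s i \<in> P i" "x = fst (sum s I)"
    unfolding set_sum_alt[OF assms] by blast
  then show "x \<in> (\<Sum>i\<in>I. fst ` P i)"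
    unfolding set_sum_alt[OF assms] by (auto simp: fst_sum intro!: exI[of _ "\<lambda>i. fst (s i)"])
next
  fix x assume "x \<in> (\<Sum>i\<in>I. fst ` P i)"
  then obtain s where "\<forall>i\<in>I. s i \<in> fst ` P i" and x: "x = sum s I"
    unfolding set_sum_alt[OF assms] by blast
  then have s: "\<forall>i\<in>I. \<exists>p. p \<in> P i \<and> s i = fst p" by blast
  from bchoice[OF s] obtain f where "\<forall>i\<in>I. f i \<in> P i \<and> s i = fst (f i)" by blast
  then have "sum f I \<in> (\<Sum>i\<in>I. P i)" "x = fst (sum f I)"
    unfolding set_sum_alt[OF assms] x by (auto simp: fst_sum)
  then show "x \<in> fst ` (\<Sum>i\<in>I. P i)" by blast
qed

lemma cbox_plus_cbox_cart:
  fixes l h l' h' :: "real ^ 'n"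
  assumes "\<And>j. l $ j \<le> h $ j" "\<And>j. l' $ j \<le> h' $ j"
  shows "cbox l h + cbox l' h' = cbox (l + l') (h + h')"
proof (intro equalityI subsetI)
  fix x assume "x \<in> cbox l h + cbox l' h'"
  then show "x \<in> cbox (l + l') (h + h')"
    by (auto elim!: set_plus_elim simp: mem_box_cart intro!: add_mono)
next
  fix x assume x: "x \<in> cbox (l + l') (h + h')"
  \<comment> \<open>Coordinatewise the least choice with l below y and x - y below h'.\<close>
  define y where "y = (\<chi> j. max (l $ j) (x $ j - h' $ j))"
  have "y \<in> cbox l h" "x - y \<in> cbox l' h'"
    using x assms by (auto simp: mem_box_cart y_def max_def algebra_simps)
  then have "y + (x - y) \<in> cbox l h + cbox l' h'" by (rule set_plus_intro)
  then show "x \<in> cbox l h + cbox l' h'" by simp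
qed

lemma sum_cbox_cart:
  fixes l h :: "'i \<Rightarrow> real ^ 'n"
  assumes "finite I" "\<And>i j. l i $ j \<le> h i $ j"
  shows "(\<Sum>i\<in>I. cbox (l i) (h i)) = cbox (\<Sum>i\<in>I. l i) (\<Sum>i\<in>I. h i)"
  using assms(1)
proof induction
  case empty
  then show ?case by (simp add: set_zero)
next
  case (insert i I)
  then show ?case by (simp add: cbox_plus_cbox_cart assms(2) sum_mono)
qed

text \<open>On the graph of the linear function given by w, the functional (u, 1) becomes u + w on
  the base.\<close>

lemma fst_lower_face_graph:
  "fst ` lower_face u ((\<lambda>x. (x, inner w x)) ` C) =
    {x \<in> C. \<forall>y\<in>C. inner (u + w) x \<le> inner (u + w) y}"
proof -
  have "lower_face u ((\<lambda>x. (x, inner w x)) ` C) =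
    (\<lambda>x. (x, inner w x)) ` {x \<in> C. \<forall>y\<in>C. inner (u + w) x \<le> inner (u + w) y}"
    by (auto simp: lower_face_def inner_add_left)
  then show ?thesis by (simp add: image_image)
qed

text \<open>The functional separates over coordinates: a negative weight selects the upper end, a
  positive one the lower end, and a zero weight the whole side.\<close>

lemma cbox_minimizers_cart:
  fixes l h w :: "real ^ 'n"
  assumes le: "\<And>j. l $ j \<le> h $ j"
  shows "{x \<in> cbox l h. \<forall>y\<in>cbox l h. inner w x \<le> inner w y} =
    cbox (\<chi> j. if w $ j < 0 then h $ j else l $ j) (\<chi> j. if w $ j \<le> 0 then h $ j else l $ j)"
proof (intro equalityI subsetI)
  fix x assume "x \<in> {x \<in> cbox l h. \<forall>y\<in>cbox l h. inner w x \<le> inner w y}"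
  then have x: "x \<in> cbox l h" and min: "\<And>y. y \<in> cbox l h \<Longrightarrow> inner w x \<le> inner w y" by auto
  have *: "w $ j * x $ j \<le> w $ j * z" if z: "l $ j \<le> z" "z \<le> h $ j" for j z
  proof -
    define y where "y = (\<chi> k. if k = j then z else x $ k)"
    have "y \<in> cbox l h" using x z by (auto simp: mem_box_cart y_def)
    then have "0 \<le> inner w y - inner w x" using min[of y] by simp
    also have "\<dots> = (\<Sum>k\<in>UNIV. if k = j then w $ j * (z - x $ j) else 0)"
      unfolding inner_vec_def sum_subtractf[symmetric]
      by (rule sum.cong) (auto simp: y_def algebra_simps)
    also have "\<dots> = w $ j * (z - x $ j)" by simp
    finally show ?thesis by (simp add: algebra_simps)
  qed
  have neg: "x $ j = h $ j" if "w $ j < 0" for j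
    using *[of j "h $ j"] le[of j] x that by (simp add: mem_box_cart order_antisym)
  have pos: "x $ j = l $ j" if "w $ j > 0" for j
    using *[of j "l $ j"] le[of j] x that by (simp add: mem_box_cart order_antisym)
  show "x \<in> cbox (\<chi> j. if w $ j < 0 then h $ j else l $ j)
      (\<chi> j. if w $ j \<le> 0 then h $ j else l $ j)"
    unfolding mem_box_cart
  proof
    fix j
    show "(\<chi> j. if w $ j < 0 then h $ j else l $ j) $ j \<le> x $ j \<and>
        x $ j \<le> (\<chi> j. if w $ j \<le> 0 then h $ j else l $ j) $ j"
      using neg[of j] pos[of j] x by (simp add: mem_box_cart)
  qed
next
  fix x assume x: "x \<in> cbox (\<chi> j. if w $ j < 0 then h $ j else l $ j)
    (\<chi> j. if w $ j \<le> 0 then h $ j else l $ j)"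
  have xb: "x \<in> cbox l h"
    unfolding mem_box_cart
  proof
    fix j show "l $ j \<le> x $ j \<and> x $ j \<le> h $ j"
      using x le[of j] by (auto simp: mem_box_cart split: if_splits dest!: spec[of _ j])
  qed
  have "inner w x \<le> inner w y" if y: "y \<in> cbox l h" for y
    unfolding inner_vec_def
  proof (rule sum_mono, simp)
    fix j
    consider "w $ j < 0" | "w $ j = 0" | "w $ j > 0" by linarith
    then show "w $ j * x $ j \<le> w $ j * y $ j"
    proof cases
      case 1
      then have "x $ j = h $ j" "y $ j \<le> h $ j"
        using x y by (auto simp: mem_box_cart split: if_splits dest!: spec[of _ j])
      then show ?thesis using 1 by simp
    next
      case 3
      then have "x $ j = l $ j" "y $ j \<ge> l $ j"
        using x y by (auto simp: mem_box_cart split: if_splits dest!: spec[of _ j])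
      then show ?thesis using 3 by simp
    qed simp
  qed
  then show "x \<in> {x \<in> cbox l h. \<forall>y\<in>cbox l h. inner w x \<le> inner w y}" using xb by auto
qed

text \<open>Translated to the origin, the box spans the coordinate subspace of its nondegenerate
  sides.\<close>

lemma aff_dim_cbox_cart:
  fixes l h :: "real ^ 'n"
  assumes le: "\<And>j. l $ j \<le> h $ j"
  shows "aff_dim (cbox l h) = int (card {j. l $ j < h $ j})"
proof -
  define c where "c = h - l"
  define J where "J = {j. l $ j < h $ j}"
  let ?V = "{x :: real ^ 'n. \<forall>i. i \<notin> J \<longrightarrow> x $ i = 0}"
  have l: "l \<in> affine hull cbox l h" by (rule hull_inc) (simp add: mem_box_cart le)
  have img: "(+) (- l) ` cbox l h = cbox 0 c"
    using cbox_translation[of "- l" l h] by (simp add: c_def image_def)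
  have "span (cbox 0 c) = ?V"
  proof (rule span_subspace)
    show "cbox 0 c \<subseteq> ?V"
    proof (intro subsetI CollectI allI impI)
      fix x i assume "x \<in> cbox 0 c" "i \<notin> J"
      then show "x $ i = 0" using le[of i]
        by (auto simp: mem_box_cart c_def J_def dest!: spec[of _ i])
    qed
    show "subspace ?V" by (auto simp: subspace_def)
    show "?V \<subseteq> span (cbox 0 c)"
    proof
      fix x assume x: "x \<in> ?V"
      have ax: "axis j (c $ j) \<in> cbox 0 c" for j
        using le by (auto simp: mem_box_cart axis_def c_def)
      \<comment> \<open>For j outside J the division by zero makes the term 0, which agrees with
        \<open>x $ j = 0\<close>.\<close>
      have "x = (\<Sum>j\<in>UNIV. (x $ j / c $ j) *\<^sub>R axis j (c $ j))"
      proof (subst vec_eq_iff, rule allI)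
        fix i
        have "(\<Sum>j\<in>UNIV. (x $ j / c $ j) *\<^sub>R axis j (c $ j)) $ i =
            (\<Sum>j\<in>UNIV. if j = i then x $ i / c $ i * c $ i else 0)"
          unfolding sum_component by (rule sum.cong) (auto simp: axis_def)
        also have "\<dots> = x $ i" using x by (auto simp: c_def J_def)
        finally show "x $ i = (\<Sum>j\<in>UNIV. (x $ j / c $ j) *\<^sub>R axis j (c $ j)) $ i" ..
      qed
      also have "\<dots> \<in> span (cbox 0 c)"
        by (intro span_sum span_scale span_base ax)
      finally show "x \<in> span (cbox 0 c)" .
    qed
  qed
  then have "dim (cbox 0 c) = card J"
    using dim_span[of "cbox 0 c"] dim_substandard_cart[where d = J and 'a = real]
    by (simp add: dim_vec_eq)
  then show ?thesis using aff_dim_eq_dim[OF l] img J_def by simp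
qed

section \<open>Box supports and the faces of their liftings\<close>

context box_system begin

text \<open>The box is the scaled unit cube, and the vertices of the cube scale to points of
  \<open>supp i\<close>.\<close>

lemma convex_hull_supp: "convex hull supp i = cbox 0 (\<chi> j. real (a i j))"
proof (rule equalityI)
  show "convex hull supp i \<subseteq> cbox 0 (\<chi> j. real (a i j))"
    by (rule hull_minimal) (auto simp: supp_def mem_box_cart convex_box)
  have unit: "cbox (0 :: real ^ 'n) 1 = convex hull {x. \<forall>i. x $ i = 0 \<or> x $ i = 1}"
    unfolding Cart_1 unit_interval_convex_hull[where 'a = "real ^ 'n"]
    by (rule arg_cong[where f = "\<lambda>x. convex hull x"]) (simp add: Basis_vec_def inner_axis)
  define f :: "real ^ 'n \<Rightarrow> real ^ 'n" where "f x = (\<chi> j. real (a i j) * x $ j)" for x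
  have f: "linear f" by (rule linearI) (auto simp: f_def vec_eq_iff algebra_simps)
  have "cbox 0 (\<chi> j. real (a i j)) \<subseteq> f ` cbox 0 1"
  proof
    fix x :: "real ^ 'n" assume x: "x \<in> cbox 0 (\<chi> j. real (a i j))"
    \<comment> \<open>Where \<open>a i j\<close> is 0, so is \<open>x $ j\<close>, and the division
      by zero gives 0.\<close>
    have "x = f (\<chi> j. x $ j / real (a i j))"
      using x by (auto simp: f_def vec_eq_iff mem_box_cart) (metis of_nat_0 order_antisym)
    moreover have "(\<chi> j. x $ j / real (a i j)) \<in> cbox 0 1"
      using x by (auto simp: mem_box_cart divide_le_eq_1)
    ultimately show "x \<in> f ` cbox 0 1" by blast
  qed
  also have "\<dots> = convex hull (f ` {x. \<forall>i. x $ i = 0 \<or> x $ i = 1})"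
    by (simp add: unit convex_hull_linear_image[OF f])
  also have "\<dots> \<subseteq> convex hull supp i"
    by (rule hull_mono) (auto simp: f_def supp_def, (metis Ints_0 Ints_of_nat mult.right_neutral mult_zero_right of_nat_0_le_iff order_refl)+)
  finally show "cbox 0 (\<chi> j. real (a i j)) \<subseteq> convex hull supp i" .
qed

text \<open>The lifting is linear, so the lifted polytope is a graph over the box and the signs of
  the weights \<open>u $ j + lam i * v $ j\<close> decide the face.\<close>

lemma fst_lower_face_lifted:
  "fst ` lower_face u (lifted (supp i) (lifting i)) =
    cbox (\<chi> j. if (u + lam i *\<^sub>R v) $ j < 0 then real (a i j) else 0)
         (\<chi> j. if (u + lam i *\<^sub>R v) $ j \<le> 0 then real (a i j) else 0)"
proof -
  have lin: "linear (\<lambda>x. (x, inner (lam i *\<^sub>R v) x))"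
    by (rule linearI) (auto simp: inner_add_right algebra_simps)
  have "lifted (supp i) (lifting i) =
      (\<lambda>x. (x, inner (lam i *\<^sub>R v) x)) ` cbox 0 (\<chi> j. real (a i j))"
    unfolding lifted_def lifting_def convex_hull_supp[symmetric] convex_hull_linear_image[OF lin]
    by simp
  then show ?thesis
    by (simp only: fst_lower_face_graph) (subst cbox_minimizers_cart, simp_all cong: if_cong)
qed

end

section \<open>Types of lattice points\<close>

definition level_count :: "('n::finite \<Rightarrow> nat) \<Rightarrow> nat \<Rightarrow> nat" where
  "level_count \<phi> i = card {j. \<phi> j = i}"

lemma sum_level_count:
  fixes \<phi> :: "'n::finite \<Rightarrow> nat"
  assumes "\<And>j. \<phi> j \<le> N"
  shows "(\<Sum>i\<le>N. level_count \<phi> i) = CARD('n)"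
  using sum.group[of "UNIV :: 'n set" "{..N}" \<phi> "\<lambda>_. 1 :: nat"] assms
  by (auto simp: level_count_def)

lemma level_count_pos_iff: "0 < level_count \<phi> i \<longleftrightarrow> (\<exists>j. \<phi> j = i)"
  by (auto simp: level_count_def card_gt_0_iff)

lemma level_count_eq_0_iff: "level_count \<phi> i = 0 \<longleftrightarrow> (\<forall>j. \<phi> j \<noteq> i)"
  by (auto simp: level_count_def)

text \<open>Any m i of the coordinates at level i may be chosen to move. Since m q is the full
  count, all of level q is chosen.\<close>

lemma exists_level_shift:
  fixes \<phi> :: "'n::finite \<Rightarrow> nat"
  assumes "m 0 = 0" "\<And>i. m i \<le> level_count \<phi> i" "m q = level_count \<phi> q" "\<And>i. q < i \<Longrightarrow> m i = 0"
  obtains M where "\<And>j. j \<in> M \<Longrightarrow> 0 < \<phi> j \<and> \<phi> j \<le> q" "\<And>j. \<phi> j = q \<Longrightarrow> j \<in> M"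
    "level_count (\<lambda>j. if j \<in> M then \<phi> j - 1 else \<phi> j) = (\<lambda>i. level_count \<phi> i - m i + m (Suc i))"
proof -
  have "\<exists>A. A \<subseteq> {j. \<phi> j = i} \<and> card A = m i" for i
    using assms(2)[of i] unfolding level_count_def by (meson obtain_subset_with_card_n)
  then obtain A where A: "\<And>i. A i \<subseteq> {j. \<phi> j = i}" "\<And>i. card (A i) = m i" by metis
  define M where "M = {j. j \<in> A (\<phi> j)}"
  have ne: "m (\<phi> j) \<noteq> 0" if "j \<in> M" for j
  proof
    assume "m (\<phi> j) = 0"
    then have "A (\<phi> j) = {}" using A(2)[of "\<phi> j"] by simp
    then show False using that by (simp add: M_def)
  qed
  show thesis
  proof (rule that[of M])
    show "0 < \<phi> j \<and> \<phi> j \<le> q" if "j \<in> M" for j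
      using ne[OF that] assms(1,4) by (metis gr0I not_le)
    have "A q = {j. \<phi> j = q}"
      using A assms(3) by (intro card_subset_eq) (auto simp: level_count_def)
    then show "j \<in> M" if "\<phi> j = q" for j using that by (auto simp: M_def)
    show "level_count (\<lambda>j. if j \<in> M then \<phi> j - 1 else \<phi> j) =
        (\<lambda>i. level_count \<phi> i - m i + m (Suc i))"
    proof
      fix i
      have "{j. (if j \<in> M then \<phi> j - 1 else \<phi> j) = i} = ({j. \<phi> j = i} - A i) \<union> A (Suc i)"
      proof (rule set_eqI)
        fix j
        have pos: "j \<in> M \<Longrightarrow> 0 < \<phi> j" using ne[of j] assms(1) by (metis gr0I)
        have mem: "j \<in> A k \<longleftrightarrow> \<phi> j = k \<and> j \<in> M" for k using A(1)[of k] by (auto simp: M_def)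
        show "j \<in> {j. (if j \<in> M then \<phi> j - 1 else \<phi> j) = i} \<longleftrightarrow>
            j \<in> ({j. \<phi> j = i} - A i) \<union> A (Suc i)"
          using pos by (auto simp: mem)
      qed
      moreover have "({j. \<phi> j = i} - A i) \<inter> A (Suc i) = {}" using A(1)[of "Suc i"] by auto
      ultimately show "level_count (\<lambda>j. if j \<in> M then \<phi> j - 1 else \<phi> j) i =
          level_count \<phi> i - m i + m (Suc i)"
        using A by (simp add: level_count_def card_Un_disjoint card_Diff_subset)
    qed
  qed
qed

section \<open>Intervals, types and the lattice points of the shifted box\<close>

locale box_subdivision = box_system a v lam \<delta>
  for a :: "nat \<Rightarrow> 'n::finite \<Rightarrow> nat" and v lam \<delta> +
  assumes a_pos: "\<And>i j. i \<le> CARD('n) \<Longrightarrow> 0 < a i j"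
    and v_neg: "\<And>j. v $ j < 0"
    and lam_Suc: "\<And>i. i < CARD('n) \<Longrightarrow> lam (Suc i) < lam i"
    and \<delta>_bounds: "\<And>j. - 1 < \<delta> $ j" "\<And>j. \<delta> $ j < 0"
begin

definition psum :: "nat \<Rightarrow> 'n \<Rightarrow> nat" where
  "psum i j = (\<Sum>k<i. a k j)"

text \<open>The condition inside \<open>type_fun\<close> as a relation, which avoids reasoning about
  \<open>THE\<close>.\<close>

definition coord_type :: "real \<Rightarrow> 'n \<Rightarrow> nat \<Rightarrow> bool" where
  "coord_type x j i \<longleftrightarrow> i \<le> CARD('n) \<and> real (psum i j) \<le> x \<and> x < real (psum (Suc i) j)"

definition has_type :: "real ^ 'n \<Rightarrow> ('n \<Rightarrow> nat) \<Rightarrow> bool" where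
  "has_type b \<phi> \<longleftrightarrow> (\<forall>j. coord_type (b $ j) j (\<phi> j))"

definition lattice_point :: "real ^ 'n \<Rightarrow> bool" where
  "lattice_point b \<longleftrightarrow> (\<forall>j. b $ j \<in> \<int>)"

text \<open>The box from \<open>lo \<phi> i\<close> to \<open>hi \<phi> i\<close> turns out to be
  the i-th summand of the cell of type \<phi>; only the sides j with \<phi> j = i can have positive
  length.\<close>

definition lo :: "('n \<Rightarrow> nat) \<Rightarrow> nat \<Rightarrow> real ^ 'n" where
  "lo \<phi> i = (\<chi> j. if i < \<phi> j then real (a i j) else 0)"

definition hi :: "('n \<Rightarrow> nat) \<Rightarrow> nat \<Rightarrow> real ^ 'n" where
  "hi \<phi> i = (\<chi> j. if i \<le> \<phi> j then real (a i j) else 0)"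

definition type_cell :: "('n \<Rightarrow> nat) \<Rightarrow> (real ^ 'n) set" where
  "type_cell \<phi> = cbox (\<chi> j. real (psum (\<phi> j) j)) (\<chi> j. real (psum (Suc (\<phi> j)) j))"

abbreviation face :: "real ^ 'n \<Rightarrow> nat \<Rightarrow> (real ^ 'n) set" where
  "face u i \<equiv> fst ` lower_face u (lifted (supp i) (lifting i))"

abbreviation cell :: "real ^ 'n \<Rightarrow> (real ^ 'n) set" where
  "cell u \<equiv> fst ` lower_face u (\<Sum>i\<le>CARD('n). lifted (supp i) (lifting i))"

lemma psum_Suc: "psum (Suc i) j = psum i j + a i j"
  by (simp add: psum_def)

lemma psum_mono: "i \<le> k \<Longrightarrow> psum i j \<le> psum k j"
  unfolding psum_def by (intro sum_mono2) auto

lemma coord_type_mono: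
  assumes "coord_type x j i" "coord_type y j k" "x \<le> y"
  shows "i \<le> k"
proof (rule ccontr)
  assume "\<not> i \<le> k"
  then have "psum (Suc k) j \<le> psum i j" by (intro psum_mono) simp
  then show False using assms by (auto simp: coord_type_def)
qed

lemma coord_type_unique: "coord_type x j i \<Longrightarrow> coord_type x j k \<Longrightarrow> i = k"
  using coord_type_mono[of x j i x k] coord_type_mono[of x j k x i] by simp

lemma has_type_unique: "has_type b \<phi> \<Longrightarrow> has_type b \<psi> \<Longrightarrow> \<phi> = \<psi>"
  by (auto simp: has_type_def intro!: ext intro: coord_type_unique)

lemma type_fun_eq: "has_type b \<phi> \<Longrightarrow> type_fun b = \<phi>"
proof
  fix j assume "has_type b \<phi>"
  then have j: "coord_type (b $ j) j (\<phi> j)" by (simp add: has_type_def)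
  have "type_fun b j = (THE i. coord_type (b $ j) j i)"
    by (simp add: type_fun_def coord_type_def psum_def lessThan_Suc_atMost)
  also have "\<dots> = \<phi> j" using j coord_type_unique by blast
  finally show "type_fun b j = \<phi> j" .
qed

lemma coord_type_exists:
  assumes "0 \<le> x" "x < real (psum (Suc CARD('n)) j)"
  obtains i where "coord_type x j i"
proof -
  define i where "i = (LEAST i. x < real (psum (Suc i) j))"
  have "x < real (psum (Suc i) j)" "i \<le> CARD('n)"
    unfolding i_def using assms(2) by (rule LeastI, intro Least_le)
  moreover have "real (psum i j) \<le> x"
  proof (cases i)
    case 0
    then show ?thesis using assms by (simp add: psum_def)
  next
    case (Suc k)
    then have "\<not> x < real (psum (Suc k) j)"
      using not_less_Least[of k "\<lambda>i. x < real (psum (Suc i) j)"] by (simp add: i_def)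
    then show ?thesis using Suc by simp
  qed
  ultimately show thesis using that by (simp add: coord_type_def)
qed

lemma coord_type_range:
  assumes "coord_type x j i"
  shows "0 \<le> x" "x < real (psum (Suc CARD('n)) j)"
proof -
  have "psum (Suc i) j \<le> psum (Suc CARD('n)) j"
    using assms by (intro psum_mono) (simp add: coord_type_def)
  then show "0 \<le> x" "x < real (psum (Suc CARD('n)) j)" using assms by (auto simp: coord_type_def)
qed

text \<open>Since \<open>x - \<delta> $ j\<close> lies strictly between the integers x and x + 1, a
  closed interval for it is a half-open one for x. This turns shifted cells into the intervals that
  define types.\<close>

lemma shifted_interval_iff:
  assumes "x \<in> \<int>"
  shows "real k \<le> x - \<delta> $ j \<and> x - \<delta> $ j \<le> real l \<longleftrightarrow> real k \<le> x \<and> x < real l"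
proof -
  obtain z where x: "x = of_int z" using assms by (auto elim: Ints_cases)
  have "real k \<le> x - \<delta> $ j \<longleftrightarrow> real k \<le> x"
  proof
    assume "real k \<le> x - \<delta> $ j"
    then have "real_of_int (int k) < of_int (z + 1)" using \<delta>_bounds(1)[of j] by (simp add: x)
    then show "real k \<le> x" unfolding of_int_less_iff by (simp add: x)
  qed (use \<delta>_bounds(2)[of j] in simp)
  moreover have "x - \<delta> $ j \<le> real l \<longleftrightarrow> x < real l"
  proof
    assume "x < real l"
    then have "of_int z < real_of_int (int l)" by (simp add: x)
    then have "real_of_int (z + 1) \<le> of_int (int l)" unfolding of_int_less_iff of_int_le_iff by simp
    then show "x - \<delta> $ j \<le> real l" using \<delta>_bounds(1)[of j] by (simp add: x)
  qed (use \<delta>_bounds(2)[of j] in simp)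
  ultimately show ?thesis by simp
qed

lemma Delta_eq: "Delta = cbox 0 (\<chi> j. real (psum (Suc CARD('n)) j))"
proof -
  have "Delta = (\<Sum>i\<le>CARD('n). cbox 0 (\<chi> j. real (a i j)))" by (simp add: Delta_def convex_hull_supp)
  also have "\<dots> = cbox (\<Sum>i\<le>CARD('n). 0) (\<Sum>i\<le>CARD('n). \<chi> j. real (a i j))" by (rule sum_cbox_cart) auto
  also have "(\<Sum>i\<le>CARD('n). \<chi> j. real (a i j)) = (\<chi> j. real (psum (Suc CARD('n)) j))"
    by (simp add: vec_eq_iff psum_def lessThan_Suc_atMost)
  finally show ?thesis by simp
qed

lemma shift_image_iff: "b \<in> (\<lambda>x. x + \<delta>) ` D \<longleftrightarrow> b - \<delta> \<in> D"
  by (force simp: image_iff)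

lemma B_iff: "b \<in> B \<longleftrightarrow> lattice_point b \<and> (\<exists>\<phi>. has_type b \<phi>)"
proof -
  have "b \<in> B \<longleftrightarrow> lattice_point b \<and> (\<forall>j. real 0 \<le> b $ j - \<delta> $ j \<and> b $ j - \<delta> $ j \<le> real (psum (Suc CARD('n)) j))"
    unfolding B_def shift_image_iff mem_Collect_eq Delta_eq mem_box_cart lattice_point_def by auto
  also have "\<dots> \<longleftrightarrow> lattice_point b \<and> (\<forall>j. real 0 \<le> b $ j \<and> b $ j < real (psum (Suc CARD('n)) j))"
    unfolding lattice_point_def by (intro conj_cong refl all_cong1 shifted_interval_iff) blast
  also have "\<dots> \<longleftrightarrow> lattice_point b \<and> (\<forall>j. \<exists>i. coord_type (b $ j) j i)"
    using coord_type_exists coord_type_range by (metis of_nat_0)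
  also have "\<dots> \<longleftrightarrow> lattice_point b \<and> (\<exists>\<phi>. has_type b \<phi>)"
    unfolding has_type_def choice_iff ..
  finally show ?thesis .
qed

lemma mem_type_cell_iff:
  assumes "lattice_point b" "\<And>j. \<phi> j \<le> CARD('n)"
  shows "b \<in> (\<lambda>x. x + \<delta>) ` type_cell \<phi> \<longleftrightarrow> has_type b \<phi>"
proof -
  have "real k \<le> (b - \<delta>) $ j \<and> (b - \<delta>) $ j \<le> real l \<longleftrightarrow> real k \<le> b $ j \<and> b $ j < real l" for j k l
    using shifted_interval_iff[of "b $ j"] assms(1) by (simp add: lattice_point_def)
  then show ?thesis
    unfolding shift_image_iff type_cell_def mem_box_cart has_type_def coord_type_def
    by (simp add: assms(2))
qed

section \<open>Full-dimensional cells and their types\<close>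

lemma lam_strict: "i < k \<Longrightarrow> k \<le> CARD('n) \<Longrightarrow> lam k < lam i"
proof (induction k)
  case (Suc k)
  then show ?case using lam_Suc[of k] by (cases "i = k") force+
qed simp

lemma weight_strict_mono:
  assumes "i < k" "k \<le> CARD('n)"
  shows "u + lam i * v $ j < u + lam k * v $ j"
  using mult_strict_right_mono_neg[OF lam_strict[OF assms] v_neg] by simp

lemma weight_sign:
  assumes "u + lam p * v $ j = 0" "p \<le> CARD('n)" "i \<le> CARD('n)"
  shows "u + lam i * v $ j < 0 \<longleftrightarrow> i < p" "u + lam i * v $ j \<le> 0 \<longleftrightarrow> i \<le> p"
  using weight_strict_mono[of i p u j] weight_strict_mono[of p i u j] assms
  by (cases i p rule: linorder_cases; simp)+

text \<open>Weights increase with the level, so their zero at \<phi> j separates the levels where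
  coordinate j is pinned at the top from those where it is pinned at 0.\<close>

lemma face_eq:
  assumes "\<And>j. u $ j + lam (\<phi> j) * v $ j = 0" "\<And>j. \<phi> j \<le> CARD('n)" "i \<le> CARD('n)"
  shows "face u i = cbox (lo \<phi> i) (hi \<phi> i)"
  unfolding fst_lower_face_lifted lo_def hi_def
  using weight_sign[OF assms(1,2,3)] by (simp cong: if_cong)

lemma cell_eq_sum: "cell u = (\<Sum>i\<le>CARD('n). face u i)"
  by (simp add: lower_face_sum fst_image_sum)

lemma lo_le_hi: "lo \<phi> i $ j \<le> hi \<phi> i $ j"
  by (simp add: lo_def hi_def)

lemma sum_indicator_psum:
  assumes "k \<le> Suc CARD('n)"
  shows "(\<Sum>i\<le>CARD('n). if i < k then real (a i j) else 0) = real (psum k j)"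
proof -
  have "(\<Sum>i\<le>CARD('n). if i < k then real (a i j) else 0) = (\<Sum>i | i \<in> {..CARD('n)} \<and> i < k. real (a i j))"
    by (rule sum.inter_filter[symmetric]) simp
  also have "{i. i \<in> {..CARD('n)} \<and> i < k} = {..<k}" using assms by auto
  finally show ?thesis by (simp add: psum_def)
qed

lemma cell_eq:
  assumes "\<And>j. u $ j + lam (\<phi> j) * v $ j = 0" "\<And>j. \<phi> j \<le> CARD('n)"
  shows "cell u = type_cell \<phi>"
proof -
  have "cell u = (\<Sum>i\<le>CARD('n). cbox (lo \<phi> i) (hi \<phi> i))"
    unfolding cell_eq_sum using face_eq[OF assms] by (intro sum.cong) auto
  also have "\<dots> = cbox (\<Sum>i\<le>CARD('n). lo \<phi> i) (\<Sum>i\<le>CARD('n). hi \<phi> i)"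
    by (rule sum_cbox_cart) (auto simp: lo_le_hi)
  also have "(\<Sum>i\<le>CARD('n). lo \<phi> i) = (\<chi> j. real (psum (\<phi> j) j))"
    using assms(2) by (simp add: vec_eq_iff lo_def sum_indicator_psum le_SucI)
  also have "(\<Sum>i\<le>CARD('n). hi \<phi> i) = (\<chi> j. real (psum (Suc (\<phi> j)) j))"
    using assms(2) by (simp add: vec_eq_iff hi_def sum_indicator_psum less_Suc_eq_le[symmetric])
  finally show ?thesis by (simp add: type_cell_def)
qed

text \<open>If the weight of coordinate j vanished at no level, every summand would be flat in
  direction j and so would the cell.\<close>

lemma full_cell_type:
  assumes "aff_dim (cell u) = int CARD('n)"
  obtains \<phi> where "\<And>j. u $ j + lam (\<phi> j) * v $ j = 0" "\<And>j. \<phi> j \<le> CARD('n)"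
proof -
  define l where "l i = (\<chi> j. if (u + lam i *\<^sub>R v) $ j < 0 then real (a i j) else 0)" for i
  define h where "h i = (\<chi> j. if (u + lam i *\<^sub>R v) $ j \<le> 0 then real (a i j) else 0)" for i
  have lh: "l i $ j \<le> h i $ j" for i j by (simp add: l_def h_def)
  have "cell u = (\<Sum>i\<le>CARD('n). cbox (l i) (h i))"
    unfolding cell_eq_sum fst_lower_face_lifted l_def h_def ..
  also have "\<dots> = cbox (\<Sum>i\<le>CARD('n). l i) (\<Sum>i\<le>CARD('n). h i)" by (rule sum_cbox_cart) (auto simp: lh)
  finally have "card {j. (\<Sum>i\<le>CARD('n). l i) $ j < (\<Sum>i\<le>CARD('n). h i) $ j} = CARD('n)"
    using assms by (simp add: aff_dim_cbox_cart sum_mono lh)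
  then have "{j. (\<Sum>i\<le>CARD('n). l i) $ j < (\<Sum>i\<le>CARD('n). h i) $ j} = UNIV"
    by (intro card_subset_eq) auto
  then have lt: "(\<Sum>i\<le>CARD('n). l i $ j) < (\<Sum>i\<le>CARD('n). h i $ j)" for j by (auto simp: set_eq_iff)
  have "\<exists>i\<le>CARD('n). u $ j + lam i * v $ j = 0" for j
  proof (rule ccontr)
    assume no: "\<not> (\<exists>i\<le>CARD('n). u $ j + lam i * v $ j = 0)"
    have "(\<Sum>i\<le>CARD('n). l i $ j) = (\<Sum>i\<le>CARD('n). h i $ j)"
      using no by (intro sum.cong) (auto simp: l_def h_def)
    then show False using lt[of j] by simp
  qed
  then show thesis using that by metis
qed

lemma type_cell_full:
  assumes "\<And>j. \<phi> j \<le> CARD('n)"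
  shows "type_cell \<phi> \<in> full_cells CARD('n) supp lifting"
proof -
  define u where "u = (\<chi> j. - lam (\<phi> j) * v $ j)"
  have "cell u = type_cell \<phi>" by (rule cell_eq) (simp_all add: u_def assms)
  moreover have "aff_dim (type_cell \<phi>) = int CARD('n)"
    unfolding type_cell_def using a_pos[OF assms]
    by (subst aff_dim_cbox_cart) (simp_all add: psum_Suc)
  ultimately show ?thesis by (auto simp: full_cells_def mixed_subdivision_def)
qed

text \<open>The cell is a type cell and the type of b is unique, so the weights of u vanish at
  \<phi>. This yields the uniqueness behind the \<open>THE\<close> in \<open>cell_of\<close> and in
  \<open>cell_component\<close>.\<close>

lemma cell_type_of_point:
  assumes "aff_dim (cell u) = int CARD('n)" "b \<in> (\<lambda>x. x + \<delta>) ` cell u" "lattice_point b" "has_type b \<phi>"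
  shows "u $ j + lam (\<phi> j) * v $ j = 0"
proof -
  obtain \<psi> where \<psi>: "\<And>j. u $ j + lam (\<psi> j) * v $ j = 0" "\<And>j. \<psi> j \<le> CARD('n)"
    using full_cell_type[OF assms(1)] by blast
  have "has_type b \<psi>"
    using assms(2,3) mem_type_cell_iff[of b \<psi>] \<psi>(2) unfolding cell_eq[OF \<psi>] by simp
  then show ?thesis using \<psi> has_type_unique assms(4) by blast
qed

lemma has_type_le: "has_type b \<phi> \<Longrightarrow> \<phi> j \<le> CARD('n)"
  by (simp add: has_type_def coord_type_def)

section \<open>Statistics of a lattice point in terms of its type\<close>

context
  fixes b \<phi> assumes b: "lattice_point b" "has_type b \<phi>"
begin

lemma cell_of_eq: "cell_of b = type_cell \<phi>"
  unfolding cell_of_def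
proof (rule the_equality)
  have le: "\<phi> j \<le> CARD('n)" for j using has_type_le[OF b(2)] .
  show "type_cell \<phi> \<in> full_cells CARD('n) supp lifting \<and> b \<in> (\<lambda>x. x + \<delta>) ` type_cell \<phi>"
    using type_cell_full[of \<phi>, OF le] mem_type_cell_iff[of b \<phi>, OF b(1) le] b(2) by simp
  fix D assume D: "D \<in> full_cells CARD('n) supp lifting \<and> b \<in> (\<lambda>x. x + \<delta>) ` D"
  then obtain u where u: "D = cell u" "aff_dim (cell u) = int CARD('n)"
    by (auto simp: full_cells_def mixed_subdivision_def)
  have "b \<in> (\<lambda>x. x + \<delta>) ` cell u" using D u(1) by blast
  from cell_type_of_point[OF u(2) this b] show "D = type_cell \<phi>"
    unfolding u(1) using le by (rule cell_eq)
qed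

lemma component_eq:
  assumes "i \<le> CARD('n)"
  shows "component b i = cbox (lo \<phi> i) (hi \<phi> i)"
  unfolding component_def cell_component_def cell_of_eq
proof (rule the_equality)
  have le: "\<phi> j \<le> CARD('n)" for j using has_type_le[OF b(2)] .
  have mem: "b \<in> (\<lambda>x. x + \<delta>) ` type_cell \<phi>" using mem_type_cell_iff[of b \<phi>, OF b(1) le] b(2) by simp
  have full: "aff_dim (type_cell \<phi>) = int CARD('n)" using type_cell_full[of \<phi>, OF le] by (simp add: full_cells_def)
  define u where "u = (\<chi> j. - lam (\<phi> j) * v $ j)"
  have u: "u $ j + lam (\<phi> j) * v $ j = 0" for j by (simp add: u_def)
  show "\<exists>u. type_cell \<phi> = cell u \<and> cbox (lo \<phi> i) (hi \<phi> i) = face u i"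
    using cell_eq[OF u le] face_eq[OF u le assms] by (intro exI[of _ u] conjI) (rule sym, assumption)+
  fix F assume "\<exists>u. type_cell \<phi> = cell u \<and> F = face u i"
  then obtain u where u: "type_cell \<phi> = cell u" "F = face u i" by blast
  \<comment> \<open>Every direction that cuts out the same cell has its zero weights at \<phi>,
    hence the same i-th face.\<close>
  have "u $ j + lam (\<phi> j) * v $ j = 0" for j
    using full mem unfolding u(1) by (rule cell_type_of_point[OF _ _ b])
  then show "F = cbox (lo \<phi> i) (hi \<phi> i)"
    unfolding u(2) using le assms by (rule face_eq)
qed

lemma t_eq:
  assumes "i \<le> CARD('n)"
  shows "t b i = int (level_count \<phi> i)"
proof -
  have "{j. lo \<phi> i $ j < hi \<phi> i $ j} = {j. \<phi> j = i}"
    using a_pos[OF assms] by (auto simp: lo_def hi_def)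
  then show ?thesis
    by (simp add: t_def component_eq[OF assms] aff_dim_cbox_cart[OF lo_le_hi] level_count_def)
qed

lemma G_iff: "b \<in> G \<longleftrightarrow> admissible CARD('n) (level_count \<phi>)"
proof -
  have "b \<in> B" using b B_iff by blast
  moreover have "(\<Sum>i\<le>I. t b i) \<le> int I + 1 \<longleftrightarrow> (\<Sum>i\<le>I. level_count \<phi> i) \<le> I + 1"
    if "I < CARD('n)" for I
  proof -
    have "(\<Sum>i\<le>I. t b i) = int (\<Sum>i\<le>I. level_count \<phi> i)" using that t_eq by simp
    then show ?thesis by linarith
  qed
  ultimately show ?thesis unfolding G_def admissible_def by simp
qed

lemma g_eq: "g b = zeros_below CARD('n) (level_count \<phi>)"
proof -
  have mixed: "in_mixed_cell b \<longleftrightarrow> (\<exists>!i. i \<le> CARD('n) \<and> level_count \<phi> i = 0)"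
    unfolding in_mixed_cell_def by (intro arg_cong[where f = Ex1] ext conj_cong refl) (simp add: t_eq)
  have "{i. i \<le> CARD('n) \<and> t b i \<ge> 2} = {i. i \<le> CARD('n) \<and> level_count \<phi> i \<ge> 2}"
    using t_eq by auto
  then have I: "I_max b = last_big CARD('n) (level_count \<phi>)"
    by (simp add: I_max_def last_big_def mixed)
  \<comment> \<open>The bound keeps the indices counted by \<open>g\<close> in the range of
    \<open>t_eq\<close>.\<close>
  have "last_big CARD('n) (level_count \<phi>) \<le> CARD('n)"
  proof (cases "\<exists>!i. i \<le> CARD('n) \<and> level_count \<phi> i = 0")
    case True
    then show ?thesis by (simp add: last_big_def)
  next
    case False
    show ?thesis using last_big(1)[OF sum_level_count[of \<phi> "CARD('n)"] False] has_type_le[OF b(2)] by blast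
  qed
  then have "{i. i < I_max b \<and> t b i = 0} =
      {i. i < last_big CARD('n) (level_count \<phi>) \<and> level_count \<phi> i = 0}"
    using t_eq by (auto simp: I)
  then show ?thesis by (simp add: g_def zeros_below_def)
qed

section \<open>Row contents\<close>

context
  fixes q assumes q: "q \<le> CARD('n)" "level_count \<phi> q = 0" "\<And>i. q < i \<Longrightarrow> i \<le> CARD('n) \<Longrightarrow> 0 < level_count \<phi> i"
begin

lemma row_index_eq: "row_index b = q"
proof -
  have "{i. i \<le> CARD('n) \<and> t b i = 0} = {i. i \<le> CARD('n) \<and> level_count \<phi> i = 0}" using t_eq by auto
  then show ?thesis unfolding row_index_def
    using q by (intro Max_eqI) (auto, metis less_irrefl not_le)
qed

lemma row_point_eq: "row_point b = lo \<phi> q"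
proof -
  have "lo \<phi> q = hi \<phi> q"
    using q(2) by (auto simp: level_count_eq_0_iff lo_def hi_def vec_eq_iff le_less)
  then have "component b q = {lo \<phi> q}" using component_eq[OF q(1)] by simp
  then show ?thesis by (auto simp: row_point_def row_index_eq)
qed

text \<open>The row point is 0 in the coordinates of type below q, which may therefore grow by up to
  \<open>a q j\<close>. In those of type above q it is already at the maximum \<open>a q j\<close>;
  they cannot grow, and the rule keeps them fixed.\<close>

lemma mem_row_contentI:
  assumes "lattice_point d" "\<And>j. b $ j \<le> d $ j" "\<And>j. d $ j \<le> b $ j + real (a q j)"
    "\<And>j. q < \<phi> j \<Longrightarrow> d $ j = b $ j"
  shows "d \<in> row_content b"
  unfolding row_content_def row_index_eq row_point_eq
proof
  show "d = b - lo \<phi> q + (d - b + lo \<phi> q)" by simp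
  show "d - b + lo \<phi> q \<in> supp q"
    using assms b(1) by (auto simp: supp_def lo_def lattice_point_def algebra_simps)
qed

end

end

end

section \<open>One descent step and the way back\<close>

context box_subdivision begin

lemma previous_point:
  assumes bG: "b \<in> G" and K: "g b = K" "0 < K"
  shows "\<exists>b'\<in>G. g b' = K - 1 \<and>
    (\<exists>bb\<in>B. bb \<in> row_content b' \<and> type_fun bb = type_fun b) \<and> reached_from b b'"
proof -
  obtain \<phi> where b: "lattice_point b" "has_type b \<phi>" using bG unfolding G_def B_iff by blast
  have le: "\<phi> j \<le> CARD('n)" for j using has_type_le[OF b(2)] .
  have adm: "admissible CARD('n) (level_count \<phi>)" using bG G_iff[OF b] by simp
  have zb: "zeros_below CARD('n) (level_count \<phi>) = K" using K g_eq[OF b] by simp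
  have out: "level_count \<phi> i = 0" if "CARD('n) < i" for i
    unfolding level_count_eq_0_iff
  proof
    fix j show "\<phi> j \<noteq> i" using le[of j] that by simp
  qed
  obtain m q where q: "q \<le> CARD('n)" and m: "m 0 = 0" "\<And>i. m i \<le> level_count \<phi> i"
      "m q = level_count \<phi> q" "\<And>i. q < i \<Longrightarrow> m i = 0"
    and above: "\<And>i. q < i \<Longrightarrow> i \<le> CARD('n) \<Longrightarrow> 0 < level_count \<phi> i"
    and adm': "admissible CARD('n) (\<lambda>i. level_count \<phi> i - m i + m (Suc i))"
    and zb': "zeros_below CARD('n) (\<lambda>i. level_count \<phi> i - m i + m (Suc i)) = K - 1"
  proof (rule exists_shift[OF sum_level_count[of \<phi>, OF le] adm out zb K(2)], goal_cases)
    case (2 m q)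
    show ?case by (rule that[of q m, OF 2(2-)])
  qed
  obtain M where M: "\<And>j. j \<in> M \<Longrightarrow> 0 < \<phi> j \<and> \<phi> j \<le> q" "\<And>j. \<phi> j = q \<Longrightarrow> j \<in> M"
    and counts: "level_count (\<lambda>j. if j \<in> M then \<phi> j - 1 else \<phi> j) =
      (\<lambda>i. level_count \<phi> i - m i + m (Suc i))"
    using exists_level_shift[of m \<phi> q, OF m] by blast
  define \<phi>' where "\<phi>' j = (if j \<in> M then \<phi> j - 1 else \<phi> j)" for j
  \<comment> \<open>The last lattice point below the interval of type \<phi> j; it has type \<phi> j
    - 1 because that interval has positive length.\<close>
  define b' where "b' = (\<chi> j. if j \<in> M then real (psum (\<phi> j) j) - 1 else b $ j)"
  have bt: "coord_type (b $ j) j (\<phi> j)" for j using b(2) by (simp add: has_type_def)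
  have b't: "coord_type (b' $ j) j (\<phi>' j)" for j
  proof (cases "j \<in> M")
    case True
    then obtain k where k: "\<phi> j = Suc k" using M(1) gr0_conv_Suc by blast
    then have "k \<le> CARD('n)" using le[of j] by simp
    then have "0 < a k j" by (rule a_pos)
    then show ?thesis
      using True k \<open>k \<le> CARD('n)\<close> by (simp add: coord_type_def b'_def \<phi>'_def psum_Suc)
  next
    case False
    then show ?thesis using bt[of j] by (simp add: b'_def \<phi>'_def)
  qed
  have b': "lattice_point b'" "has_type b' \<phi>'"
    using b(1) b't by (auto simp: lattice_point_def has_type_def b'_def)
  have b'_le: "b' $ j \<le> b $ j" for j
    using bt[of j] by (simp add: b'_def coord_type_def)
  have b'M: "b' $ j + 1 \<le> b $ j" if "j \<in> M" for j
    using bt[of j] that by (simp add: b'_def coord_type_def)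
  have \<phi>'_counts: "level_count \<phi>' = (\<lambda>i. level_count \<phi> i - m i + m (Suc i))"
    using counts unfolding \<phi>'_def[abs_def] .
  have "b' \<in> G" "g b' = K - 1"
    using G_iff[OF b'] g_eq[OF b'] adm' zb' \<phi>'_counts by simp_all
  \<comment> \<open>Invariant of the way back: a point c between b' and b that still agrees with b'
    in the coordinates of type q has row index q. So d between c and b is in its row content if the
    other coordinates grow by at most 1.\<close>
  have between: "c \<in> B \<and> (lattice_point d \<and> (\<forall>j. c $ j \<le> d $ j \<and> d $ j \<le> b $ j) \<and>
      (\<forall>j. \<phi> j \<noteq> q \<longrightarrow> d $ j \<le> c $ j + 1) \<longrightarrow> d \<in> row_content c)"
    if c: "lattice_point c" "\<And>j. b' $ j \<le> c $ j" "\<And>j. c $ j \<le> b $ j"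
      "\<And>j. \<phi> j = q \<Longrightarrow> c $ j = b' $ j" for c d
  proof -
    have "\<exists>i. coord_type (c $ j) j i" for j
    proof (rule coord_type_exists)
      show "0 \<le> c $ j" using coord_type_range(1)[OF b't[of j]] c(2)[of j] by simp
      show "c $ j < real (psum (Suc CARD('n)) j)"
        using coord_type_range(2)[OF bt[of j]] c(3)[of j] by simp
    qed blast
    then obtain \<psi> where \<psi>: "\<And>j. coord_type (c $ j) j (\<psi> j)" by metis
    then have ct: "has_type c \<psi>" by (simp add: has_type_def)
    have \<psi>_le: "\<psi> j \<le> \<phi> j" for j using coord_type_mono[OF \<psi> bt c(3)] .
    have fixed: "c $ j = b $ j" "\<psi> j = \<phi> j" if "q < \<phi> j" for j
    proof -
      have "j \<notin> M" using M(1)[of j] that by auto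
      then show "c $ j = b $ j" using c(2)[of j] c(3)[of j] by (simp add: b'_def)
      then show "\<psi> j = \<phi> j" using coord_type_unique[OF \<psi>[of j]] bt[of j] by simp
    qed
    \<comment> \<open>A coordinate of type q in c would have type at least q in b. Above q it is
      unmoved, and at q it still agrees with b', where its type is q - 1.\<close>
    have "\<psi> j \<noteq> q" for j
    proof
      assume j: "\<psi> j = q"
      then have "\<phi> j = q" using \<psi>_le[of j] fixed(2)[of j] by fastforce
      then have "j \<in> M" "c $ j = b' $ j" using M(2) c(4) by auto
      then have "\<psi> j = \<phi> j - 1"
        using coord_type_unique[OF \<psi>[of j]] b't[of j] by (simp add: \<phi>'_def)
      then show False using j \<open>\<phi> j = q\<close> M(1)[OF \<open>j \<in> M\<close>] by simp
    qed
    then have row: "level_count \<psi> q = 0" by (simp add: level_count_eq_0_iff)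
    have row_above: "0 < level_count \<psi> i" if "q < i" "i \<le> CARD('n)" for i
      using above[OF that] fixed(2) that unfolding level_count_pos_iff by metis
    have "d \<in> row_content c" if d: "lattice_point d" "\<And>j. c $ j \<le> d $ j" "\<And>j. d $ j \<le> b $ j"
      "\<And>j. \<phi> j \<noteq> q \<Longrightarrow> d $ j \<le> c $ j + 1"
    proof (rule mem_row_contentI[OF c(1) ct q row row_above d(1,2)])
      fix j
      show "d $ j \<le> c $ j + real (a q j)"
      proof (cases "\<phi> j = q")
        case True
        \<comment> \<open>Here b' is at \<open>psum q j\<close> - 1 and the integer coordinate of b
          is at most \<open>psum q j\<close> + \<open>a q j\<close> - 1, so the whole rise fits into
          one row content.\<close>
        have "b $ j < real (psum q j) + real (a q j)"
          using bt[of j] by (simp add: True coord_type_def psum_Suc)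
        moreover obtain z where z: "b $ j = of_int z"
          using b(1) unfolding lattice_point_def by (metis Ints_cases)
        ultimately have "real_of_int z < of_int (int (psum q j) + int (a q j))" by simp
        then have "z + 1 \<le> int (psum q j) + int (a q j)" unfolding of_int_less_iff by simp
        then have "real_of_int (z + 1) \<le> of_int (int (psum q j) + int (a q j))"
          unfolding of_int_le_iff .
        then have "b $ j \<le> b' $ j + real (a q j)"
          using True M(2)[OF True] z by (simp add: b'_def)
        then show ?thesis using d(3)[of j] c(4)[OF True] by simp
      next
        case False
        then show ?thesis using d(4)[OF False] a_pos[OF q, of j] by simp
      qed
      assume "q < \<psi> j"
      then have "q < \<phi> j" using \<psi>_le[of j] by simp
      then show "d $ j = c $ j" using fixed(1) d(2,3) by (metis order_antisym)
    qed
    moreover have "c \<in> B" using c(1) ct B_iff by blast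
    ultimately show ?thesis by blast
  qed
  \<comment> \<open>Moved coordinates take the least lattice point of their old interval, so one
    unit step from b' restores their type.\<close>
  define bb where "bb = (\<chi> j. if j \<in> M then b' $ j + 1 else b $ j)"
  have "has_type bb \<phi>"
    unfolding has_type_def
  proof
    fix j show "coord_type (bb $ j) j (\<phi> j)"
      using bt[of j] a_pos[OF le[of j], of j]
      by (simp add: bb_def b'_def coord_type_def psum_Suc)
  qed
  moreover have bbl: "lattice_point bb" using b(1) b'(1) by (simp add: lattice_point_def bb_def)
  ultimately have "bb \<in> B" "type_fun bb = type_fun b"
    using B_iff type_fun_eq b(2) by auto
  moreover have "bb \<in> row_content b'"
    using between[of b' bb] b'(1) b'_le bbl b'M M(2)
    by (auto simp: bb_def) (auto simp: b'_def)
  moreover have "reached_from b b'"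
  proof -
    \<comment> \<open>The differences are nonnegative, so their sum bounds each of them, and R unit
      steps complete every coordinate not of type q.\<close>
    obtain R where R: "(\<Sum>j\<in>UNIV. b $ j - b' $ j) \<le> real R" using real_arch_simple by blast
    have R: "b $ j - b' $ j \<le> real R" for j
      using member_le_sum[of j UNIV "\<lambda>j. b $ j - b' $ j"] b'_le R by simp
    \<comment> \<open>Up to index R the coordinates of type q wait at b' while the others climb,
      capped at b. The value b at index R + 1 is the final step.\<close>
    define c where "c k = (if k \<le> R then
      (\<chi> j. if \<phi> j = q then b' $ j else min (b $ j) (b' $ j + real k)) else b)" for k
    have c: "lattice_point (c k)" "b' $ j \<le> c k $ j" "c k $ j \<le> b $ j" for k j
      using b(1) b'(1) b'_le by (auto simp: lattice_point_def c_def min_def)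
    have c_q: "c k $ j = b' $ j" if "k \<le> R" "\<phi> j = q" for k j using that by (simp add: c_def)
    have step: "c (Suc k) \<in> row_content (c k)" if k: "k \<le> R" for k
    proof -
      have "c k $ j \<le> c (Suc k) $ j \<and> (\<phi> j \<noteq> q \<longrightarrow> c (Suc k) $ j \<le> c k $ j + 1)" for j
      proof (cases "Suc k \<le> R")
        case True
        then show ?thesis using b'_le[of j] by (auto simp: c_def min_def)
      next
        case False
        \<comment> \<open>At index R the coordinates of other types have arrived, so the last step
          changes only those of type q.\<close>
        then have "k = R" using k by simp
        then show ?thesis using c(3)[of k j] R[of j] by (auto simp: c_def min_def)
      qed
      then show ?thesis using between[OF c(1-3) c_q[OF k], of "c (Suc k)"] c by blast
    qed
    have "c k \<in> B" for k
    proof (cases "k \<le> R")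
      case True
      show ?thesis using between[OF c(1-3) c_q[OF True], of b] by blast
    next
      case False
      then show ?thesis using b B_iff by (auto simp: c_def)
    qed
    moreover have "c 0 = b'" by (simp add: c_def vec_eq_iff b'_le min_absorb2)
    moreover have "c (Suc R) = b" by (simp add: c_def)
    ultimately show ?thesis
      unfolding reached_from_def using step less_Suc_eq_le by blast
  qed
  ultimately show ?thesis using \<open>b' \<in> G\<close> \<open>g b' = K - 1\<close> by blast
qed

end

theorem theorem3p13:
  fixes a :: "nat \<Rightarrow> 'n::finite \<Rightarrow> nat"
    and v :: "real ^ 'n"
  assumes a_pos: "\<And>i j. i \<le> CARD('n) \<Longrightarrow> 0 < a i j"
    and a_mono: "\<And>i k j. i \<le> k \<Longrightarrow> k < CARD('n) \<Longrightarrow> a i j \<le> a k j"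
    and v_neg: "\<And>j. v $ j < 0"
  shows "\<exists>\<epsilon>>0. \<forall>lam :: nat \<Rightarrow> real.
    (\<forall>i<CARD('n). lam (Suc i) < lam i) \<and> 0 \<le> lam CARD('n) \<and> lam 0 < \<epsilon> \<longrightarrow>
    (\<exists>\<eta>>0. \<forall>\<delta> :: real ^ 'n.
      (\<forall>j. - \<eta> < \<delta> $ j \<and> \<delta> $ j < 0) \<and> box_system.generic_shift a v lam \<delta> \<longrightarrow>
      (\<forall>b \<in> box_system.G a v lam \<delta>. \<forall>K > 0. box_system.g a v lam \<delta> b = K \<longrightarrow>
        (\<exists>b' \<in> box_system.G a v lam \<delta>.
           box_system.g a v lam \<delta> b' = K - 1 \<and>
           (\<exists>bb \<in> box_system.B a \<delta>.
              bb \<in> box_system.row_content a v lam \<delta> b' \<and>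
              box_system.type_fun a bb = box_system.type_fun a b) \<and>
           box_system.reached_from a v lam \<delta> b b')))"
proof (rule exI[of _ 1], intro conjI allI impI, simp)
  fix lam :: "nat \<Rightarrow> real"
  assume lam: "(\<forall>i<CARD('n). lam (Suc i) < lam i) \<and> 0 \<le> lam CARD('n) \<and> lam 0 < 1"
  show "\<exists>\<eta>>0. \<forall>\<delta> :: real ^ 'n.
      (\<forall>j. - \<eta> < \<delta> $ j \<and> \<delta> $ j < 0) \<and> box_system.generic_shift a v lam \<delta> \<longrightarrow>
      (\<forall>b \<in> box_system.G a v lam \<delta>. \<forall>K > 0. box_system.g a v lam \<delta> b = K \<longrightarrow>
        (\<exists>b' \<in> box_system.G a v lam \<delta>.
           box_system.g a v lam \<delta> b' = K - 1 \<and>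
           (\<exists>bb \<in> box_system.B a \<delta>.
              bb \<in> box_system.row_content a v lam \<delta> b' \<and>
              box_system.type_fun a bb = box_system.type_fun a b) \<and>
           box_system.reached_from a v lam \<delta> b b'))"
  proof (rule exI[of _ 1], intro conjI allI impI ballI, simp)
    fix \<delta> :: "real ^ 'n" and b K
    assume \<delta>: "(\<forall>j. - 1 < \<delta> $ j \<and> \<delta> $ j < 0) \<and> box_system.generic_shift a v lam \<delta>"
    interpret box_subdivision a v lam \<delta>
      using a_pos v_neg lam \<delta> by unfold_locales auto
    assume "b \<in> G" "0 < K" "g b = K"
    then show "\<exists>b' \<in> G. g b' = K - 1 \<and>
        (\<exists>bb \<in> B. bb \<in> row_content b' \<and> type_fun bb = type_fun b) \<and> reached_from b b'"
      by (intro previous_point)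
  qed
qed

end
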